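(* Let $H = (V, E)$ be a hypergraph of arity $d$ with $N$ vertices and $M$ hyperedges, let $\beta \in [0,1]$, and let $t$ and $q$ be positive integers. Suppose that (1) $t$ divides $M$, (2) $1/t > \beta$, and (3) every vertex subset $V' \subseteq V$ fully contains at most $(|V'|/N)^d M + \beta M$ hyperedges. Let $\mathbf{P} \in \{0,1\}^{M \times N}$ be the indicator matrix of $H$, and let $\mathbf{T} = [\mathbf{A} \,\|\, \mathbf{Q}]$ be the $(t, q)$-VF tensor product of $\mathbf{P}$. Then for all vectors $\mathbf{x} \in \mathbb{Z}^{M^q}$ with $\mathbf{x} \mathbf{A} = \mathbf{0}$ and all $\delta \in [0,1]$ the following holds: letting $E' \subseteq [M]^q$ be the set of indices of the nonzero entries of $\mathbf{x}$, if $|E'| > \frac{M^q\delta^d}{(1 - \beta t)^q}$, then the rows of $\mathbf{Q}$ indexed by $E'$ have their nonzero entries supported on more than $N^q\delta$ distinct columns.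
   Context: Vectors are row vectors. The indicator matrix of a hypergraph of arity $d$ with $N$ vertices and $M$ hyperedges is $\mathbf{P}\in\{0,1\}^{M\times N}$ with one column per vertex and one row per hyperedge, each row having $1$s exactly at the $d$ vertices of that hyperedge. A vertex subset fully contains a hyperedge if all vertices of the hyperedge lie in it. $\mathbf{P}^{\otimes q}$ is the $q$-fold Kronecker (tensor) product, with rows indexed by $[M]^q$ and columns by $[N]^q$. For positive integers $a>b$ with $a$ prime, an $(a,b)$ reduced Vandermonde matrix is $\mathbf{V}\in\mathbb{Z}^{(a-1)\times b}$ with $\mathbf{V}_{i,j}=i^{j-1}\bmod a$ (the representative in $\{0,\dots,a-1\}$). The $(t,q)$-VF tensor product of $\mathbf{P}$ (with $t\mid M$) is constructed as follows: let $\mathbf{Q}=\mathbf{P}^{\otimes q}$; let $\mathcal{S}$ be the collection of all sets $\{(e_1,\dots,e_{\ell-1},e'_\ell,e_{\ell+1},\dots,e_q): e'_\ell\in[M]\}$ over all $\ell\in[q]$ and all fixed $e_1,\dots,e_{\ell-1},e_{\ell+1},\dots,e_q\in[M]$; let $a$ be a prime with $M^q<a<3M^q$, let $\mathbf{V}$ be an $(a,M/t)$ reduced Vandermonde matrix, and index its first $M^q$ rows by distinct elements of $[M]^q$; for each $S\in\mathcal{S}$ let $\mathbf{A}^{(S)}\in\mathbb{Z}^{M^q\times M/t}$ have row $\mathbf{e}$ equal to $\mathbf{V}_{\mathbf{e}}$ if $\mathbf{e}\in S$ and equal to $\mathbf{0}$ otherwise; let $\mathbf{A}\in\mathbb{Z}^{M^q\times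 qM^q/t}$ be the horizontal concatenation of all $\mathbf{A}^{(S)}$; the VF tensor product is $\mathbf{T}=[\mathbf{A}\,\|\,\mathbf{Q}]$ (rows indexed by $[M]^q$). *)

theory Defs
  imports Complex_Main "HOL-Library.FuncSet" "HOL-Computational_Algebra.Primes"
begin

text \<open>
  A matrix with rows indexed by a finite set \<open>R\<close> and columns indexed by a finite set \<open>C\<close> is a
  function \<open>A\<close> of a row index and a column index, of which only the values on \<open>R \<times> C\<close>
  matter.  This allows tuples in \<open>[M]^q\<close> as row indices without flattening them to numbers.
  Throughout, \<open>[n]\<close> is \<open>{1..n}\<close>.
\<close>

type_synonym ('r, 'c) int_matrix = "'r \<Rightarrow> 'c \<Rightarrow> int"

text \<open>Hyperedges are sets of exactly \<open>d\<close> vertices.\<close>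

definition hypergraph :: "nat \<Rightarrow> 'v set \<Rightarrow> 'v set set \<Rightarrow> bool" where
  "hypergraph d V E \<longleftrightarrow> finite V \<and> (\<forall>h\<in>E. h \<subseteq> V \<and> card h = d)"

text \<open>\<open>[M] \<times> [N]\<close> matrices; the order of the hyperedges and of the vertices is arbitrary.\<close>

definition indicator_matrix :: "'v set \<Rightarrow> 'v set set \<Rightarrow> (nat, nat) int_matrix \<Rightarrow> bool" where
  "indicator_matrix V E P \<longleftrightarrow>
     (\<exists>edge vert. bij_betw edge {1..card E} E \<and> bij_betw vert {1..card V} V \<and>
        (\<forall>i\<in>{1..card E}. \<forall>j\<in>{1..card V}. P i j = (if vert j \<in> edge i then 1 else 0)))"

definition tuples :: "nat \<Rightarrow> nat \<Rightarrow> (nat \<Rightarrow> nat) set" where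
  "tuples q n = {1..q} \<rightarrow>\<^sub>E {1..n}"

definition tensor_power :: "nat \<Rightarrow> (nat, nat) int_matrix \<Rightarrow> (nat \<Rightarrow> nat, nat \<Rightarrow> nat) int_matrix" where
  "tensor_power q P e v = (\<Prod>l\<in>{1..q}. P (e l) (v l))"

definition axis_lines :: "nat \<Rightarrow> nat \<Rightarrow> (nat \<Rightarrow> nat) set set" where
  "axis_lines q M = {{e(l := m) | m. m \<in> {1..M}} | e l. e \<in> tuples q M \<and> l \<in> {1..q}}"

text \<open>
  The \<open>(a, b)\<close> reduced Vandermonde matrix is the restriction of this function to rows
  \<open>[a - 1]\<close> and columns \<open>[b]\<close>.
\<close>

definition reduced_vandermonde :: "nat \<Rightarrow> (nat, nat) int_matrix" where
  "reduced_vandermonde a i j = int (i ^ (j - 1) mod a)"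

text \<open>
  The block of a line \<open>S\<close>; \<open>r\<close> assigns to each tuple the row of the Vandermonde matrix \<open>W\<close>
  that it indexes.
\<close>

definition VF_block ::
  "(nat, nat) int_matrix \<Rightarrow> ((nat \<Rightarrow> nat) \<Rightarrow> nat) \<Rightarrow> (nat \<Rightarrow> nat) set \<Rightarrow> (nat \<Rightarrow> nat, nat) int_matrix" where
  "VF_block W r S e j = (if e \<in> S then W (r e) j else 0)"

text \<open>
  Horizontal concatenations: for a family of blocks \<open>B S\<close>, column \<open>(S, j)\<close> is column \<open>j\<close> of
  block \<open>S\<close>; for two matrices, the column index set is the disjoint sum.
\<close>

definition hconcat_family :: "('s \<Rightarrow> ('r, 'c) int_matrix) \<Rightarrow> ('r, 's \<times> 'c) int_matrix" where
  "hconcat_family B e c = B (fst c) e (snd c)"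

definition hconcat :: "('r, 'c1) int_matrix \<Rightarrow> ('r, 'c2) int_matrix \<Rightarrow> ('r, 'c1 + 'c2) int_matrix" where
  "hconcat A B e c = (case c of Inl c1 \<Rightarrow> A e c1 | Inr c2 \<Rightarrow> B e c2)"

text \<open>Column indices of the left part of the VF tensor product.\<close>

definition VF_columns :: "nat \<Rightarrow> nat \<Rightarrow> nat \<Rightarrow> ((nat \<Rightarrow> nat) set \<times> nat) set" where
  "VF_columns M t q = axis_lines q M \<times> {1..M div t}"

text \<open>
  The construction depends on the choice of the prime \<open>a\<close> and of the indexing \<open>r\<close> of the first
  \<open>M ^ q\<close> Vandermonde rows, so it is a relation; \<open>M\<close> is the number of rows of \<open>P\<close>.
\<close>

definition VF_tensor_product ::
  "nat \<Rightarrow> nat \<Rightarrow> nat \<Rightarrow> (nat, nat) int_matrix \<Rightarrow>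
   (nat \<Rightarrow> nat, ((nat \<Rightarrow> nat) set \<times> nat) + (nat \<Rightarrow> nat)) int_matrix \<Rightarrow> bool" where
  "VF_tensor_product M t q P T \<longleftrightarrow>
     t dvd M \<and>
     (\<exists>a r. prime a \<and> M ^ q < a \<and> a < 3 * M ^ q \<and>
        bij_betw r (tuples q M) {1..M ^ q} \<and>
        T = hconcat (hconcat_family (VF_block (reduced_vandermonde a) r)) (tensor_power q P))"

text \<open>Row vector times matrix, for row index set \<open>R\<close>.\<close>

definition vec_mat_mult :: "'r set \<Rightarrow> ('r \<Rightarrow> int) \<Rightarrow> ('r, 'c) int_matrix \<Rightarrow> 'c \<Rightarrow> int" where
  "vec_mat_mult R x A c = (\<Sum>e\<in>R. x e * A e c)"

definition column_support :: "'r set \<Rightarrow> 'c set \<Rightarrow> ('r, 'c) int_matrix \<Rightarrow> 'c set" where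
  "column_support R C B = {c\<in>C. \<exists>e\<in>R. B e c \<noteq> 0}"

end

theory Submission
  imports Defs "HOL-Computational_Algebra.Polynomial"
begin

text \<open>
  Any \<open>b\<close> rows of an \<open>(a, b)\<close> reduced Vandermonde matrix are linearly independent, so the support
  of a vector in the left kernel of \<open>A\<close> meets each axis-parallel line of \<open>[M]^q\<close> either not at all
  or in more than \<open>M / t\<close> points.  On sets of edges that are empty or have at least \<open>M / t\<close> elements,
  the additive error \<open>\<beta> M\<close> is at most \<open>\<beta> t\<close> times the number of edges, so if such a
  set \<open>F\<close> is fully contained in \<open>W\<close>, then \<open>|F| \<le> L |W|^d\<close> with \<open>L = M / (N^d (1 - \<beta> t))\<close>.  Such a bound tensorises, by induction
  on \<open>q\<close>, to \<open>|X| \<le> L^q |C|^d\<close> for a line-rich set \<open>X\<close> whose rows of \<open>Q\<close> have column support \<open>C\<close>.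
  In the step, \<open>U\<^sub>m\<close> denotes the column support of the slice of \<open>X\<close> with last edge \<open>m\<close>; for each column
  \<open>w\<close> the set of \<open>m\<close> with \<open>w \<in> U\<^sub>m\<close> is empty or large, and Minkowski's inequality combines the
  one-dimensional bounds over all \<open>w\<close>.
\<close>

section \<open>Independence of Vandermonde rows\<close>

text \<open>Combining the equations with the coefficients of a polynomial \<open>p\<close> that
  vanishes at every node except that of \<open>e0\<close> leaves only the term of \<open>e0\<close>.
  Distinct nodes below \<open>a\<close> make the value of \<open>p\<close> there a unit modulo
  \<open>a\<close>.\<close>

lemma vandermonde_prime_dvd:
  fixes r :: "'e \<Rightarrow> nat" and x :: "'e \<Rightarrow> int"
  assumes a: "prime a" and S: "finite S" "card S \<le> b"
    and r: "inj_on r S" "r ` S \<subseteq> {..<a}"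
    and zero: "\<And>j. j < b \<Longrightarrow> (\<Sum>e\<in>S. x e * int (r e ^ j mod a)) = 0"
    and e0: "e0 \<in> S"
  shows "int a dvd x e0"
proof -
  define p :: "int poly" where "p = (\<Prod>e\<in>S - {e0}. [:- int (r e), 1:])"
  have deg: "degree p < b"
  proof -
    have "degree p \<le> (\<Sum>e\<in>S - {e0}. degree [:- int (r e), 1:])"
      unfolding p_def using degree_prod_sum_le[of "S - {e0}" "\<lambda>e. [:- int (r e), 1:]"] S
      by (simp add: o_def)
    also have "\<dots> = card S - 1" using S e0 by simp
    \<comment> \<open>Since \<open>e0 \<in> S\<close>, the subtraction in \<open>card S - 1\<close>
      is not truncated and the bound is strict.\<close>
    finally show ?thesis using S e0 card_gt_0_iff[of S] by force
  qed
  have poly_p: "poly p z = (\<Prod>e\<in>S - {e0}. z - int (r e))" for z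
    by (simp add: p_def poly_prod)
  have power_sum: "int a dvd (\<Sum>e\<in>S. x e * int (r e) ^ j)" if "j < b" for j
  proof -
    have "int a dvd (\<Sum>e\<in>S. x e * int (r e) ^ j) - (\<Sum>e\<in>S. x e * int (r e ^ j mod a))"
      unfolding sum_subtractf[symmetric]
    proof (rule dvd_sum)
      fix e
      have "int a dvd int (r e) ^ j - int (r e ^ j mod a)"
        by (simp add: zmod_int dvd_minus_mod)
      then show "int a dvd x e * int (r e) ^ j - x e * int (r e ^ j mod a)"
        by (simp add: right_diff_distrib[symmetric])
    qed
    then show ?thesis using zero[OF that] by simp
  qed
  have "(\<Sum>e\<in>S. x e * poly p (int (r e)))
      = (\<Sum>j\<le>degree p. coeff p j * (\<Sum>e\<in>S. x e * int (r e) ^ j))"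
    unfolding poly_altdef sum_distrib_left by (subst sum.swap) (simp add: mult_ac)
  then have "int a dvd (\<Sum>e\<in>S. x e * poly p (int (r e)))"
    using deg by (auto intro!: dvd_sum dvd_mult power_sum)
  also have "(\<Sum>e\<in>S. x e * poly p (int (r e))) = x e0 * poly p (int (r e0))"
  proof -
    have "poly p (int (r e)) = 0" if "e \<in> S - {e0}" for e
      using that S by (auto simp: poly_p intro!: bexI[of _ e])
    then show ?thesis using S e0 by (simp add: sum.remove)
  qed
  finally have dvd: "int a dvd x e0 * poly p (int (r e0))" .
  have a': "prime (int a)" using a by simp
  have "\<not> int a dvd poly p (int (r e0))"
  proof
    assume "int a dvd poly p (int (r e0))"
    then obtain e where e: "e \<in> S - {e0}" "int a dvd int (r e0) - int (r e)"
      unfolding poly_p using iffD1[OF prime_dvd_prod_iff[OF _ a']] S by (meson finite_Diff)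
    have "r e0 < a" "r e < a" using r e e0 by auto
    then have "\<bar>int (r e0) - int (r e)\<bar> < int a" by linarith
    moreover have "r e0 \<noteq> r e" using r e e0 by (auto dest: inj_onD)
    ultimately show False
      using dvd_imp_le_int[OF _ e(2)] by simp
  qed
  then show ?thesis using dvd a' prime_dvd_mult_iff by blast
qed

text \<open>
  Independence modulo \<open>a\<close> lifts to the integers by descent: a vanishing combination is
  divisible by \<open>a\<close>, and dividing by \<open>a\<close> gives another one.
\<close>

lemma vandermonde_independent:
  fixes r :: "'e \<Rightarrow> nat" and x :: "'e \<Rightarrow> int"
  assumes a: "prime a" and S: "finite S" "card S \<le> b"
    and r: "inj_on r S" "r ` S \<subseteq> {..<a}"
    and zero: "\<And>j. j < b \<Longrightarrow> (\<Sum>e\<in>S. x e * int (r e ^ j mod a)) = 0"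
    and e0: "e0 \<in> S"
  shows "x e0 = 0"
proof -
  have "int a ^ k dvd x e0" for k
    using zero
  proof (induction k arbitrary: x)
    case 0
    then show ?case by simp
  next
    case (Suc k)
    define y where "y e = x e div int a" for e
    have y: "x e = int a * y e" if "e \<in> S" for e
      using vandermonde_prime_dvd[OF a S r Suc.prems that] by (simp add: y_def)
    have "(\<Sum>e\<in>S. y e * int (r e ^ j mod a)) = 0" if "j < b" for j
    proof -
      have "int a * (\<Sum>e\<in>S. y e * int (r e ^ j mod a)) = (\<Sum>e\<in>S. x e * int (r e ^ j mod a))"
        unfolding sum_distrib_left by (rule sum.cong) (simp_all add: y)
      then show ?thesis using Suc.prems[OF that] a by (simp add: prime_gt_0_nat)
    qed
    then have "int a ^ k dvd y e0" by (rule Suc.IH)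
    then show ?case using y[OF e0] by simp
  qed
  \<comment> \<open>Any power of \<open>a\<close> exceeding the absolute value of
    \<open>x e0\<close> would do.\<close>
  then have "int a ^ nat \<bar>x e0\<bar> dvd x e0" .
  moreover have "\<bar>x e0\<bar> < int a ^ nat \<bar>x e0\<bar>"
    using power_gt_expt[of a "nat \<bar>x e0\<bar>"] prime_gt_1_nat[OF a]
    by (metis One_nat_def abs_ge_zero int_nat_eq of_nat_less_iff of_nat_power)
  ultimately show ?thesis
    using dvd_imp_le_int[of "x e0" "int a ^ nat \<bar>x e0\<bar>"] by (cases "x e0 = 0") simp_all
qed

section \<open>Kernel vectors on axis-parallel lines\<close>

lemma finite_tuples: "finite (tuples q n)"
  by (simp add: tuples_def finite_PiE)

text \<open>Only support points on the line contribute to the columns of its block, which gives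
  \<open>M div t\<close> Vandermonde equations. If there were at most \<open>M div t\<close> such
  points, independence would force \<open>x e = 0\<close>.\<close>

lemma line_support_large:
  fixes x :: "(nat \<Rightarrow> nat) \<Rightarrow> int"
  assumes a: "prime a" "M ^ q < a" and r: "bij_betw r (tuples q M) {1..M ^ q}"
    and zero: "\<forall>c\<in>VF_columns M t q.
      vec_mat_mult (tuples q M) x (hconcat_family (VF_block (reduced_vandermonde a) r)) c = 0"
    and e: "e \<in> tuples q M" "x e \<noteq> 0" and l: "l \<in> {1..q}"
  shows "M div t < card {m\<in>{1..M}. e(l := m) \<in> tuples q M \<and> x (e(l := m)) \<noteq> 0}"
proof (rule ccontr)
  assume small: "\<not> ?thesis"
  let ?F = "{m\<in>{1..M}. e(l := m) \<in> tuples q M \<and> x (e(l := m)) \<noteq> 0}"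
  define L where "L = {e(l := m) | m. m \<in> {1..M}}"
  define S where "S = {f\<in>tuples q M. f \<in> L \<and> x f \<noteq> 0}"
  have "S = (\<lambda>m. e(l := m)) ` ?F" by (auto simp: S_def L_def)
  then have cS: "card S \<le> M div t"
    using small card_image_le[of ?F "\<lambda>m. e(l := m)"] by simp
  have "e l \<in> {1..M}" using e l by (auto simp: tuples_def)
  then have eS: "e \<in> S" using e by (auto simp: S_def L_def intro!: exI[of _ "e l"])
  have S: "S \<subseteq> tuples q M" "finite S" using finite_tuples by (auto simp: S_def)
  have L: "L \<in> axis_lines q M" using e l by (auto simp: axis_lines_def L_def)
  have rS: "inj_on r S" "r ` S \<subseteq> {..<a}"
  proof -
    show "inj_on r S" using r S by (auto simp: bij_betw_def intro: inj_on_subset)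
    have "r f \<le> M ^ q" if "f \<in> S" for f
      using that bij_betw_apply[OF r, of f] S by auto
    then show "r ` S \<subseteq> {..<a}" using a(2) by (auto intro: le_less_trans)
  qed
  have "(\<Sum>f\<in>S. x f * int (r f ^ j mod a)) = 0" if j: "j < M div t" for j
  proof -
    \<comment> \<open>Column \<open>j\<close> of the Vandermonde matrix carries the exponent
      \<open>j - 1\<close>, so exponent \<open>j\<close> sits in column
      \<open>Suc j\<close>.\<close>
    have "(L, Suc j) \<in> VF_columns M t q" using L j by (simp add: VF_columns_def)
    then have "0 = (\<Sum>f\<in>tuples q M. x f * (if f \<in> L then int (r f ^ j mod a) else 0))"
      using bspec[OF zero, of "(L, Suc j)"]
      by (simp add: vec_mat_mult_def hconcat_family_def VF_block_def reduced_vandermonde_def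
        cong: if_cong)
    also have "\<dots> = (\<Sum>f\<in>S. x f * int (r f ^ j mod a))"
      by (rule sum.mono_neutral_cong_right[OF finite_tuples]) (auto simp: S_def)
    finally show ?thesis by simp
  qed
  then have "x e = 0"
    by (rule vandermonde_independent[OF a(1) S(2) cS rS _ eS])
  then show False using e by simp
qed

section \<open>Minkowski's inequality for cardinalities\<close>

text \<open>
  A form of Minkowski's inequality in \<open>\<ell>\<^sup>d\<close> for the indicator functions of the sets
  \<open>{m. R m w}\<close>; expanding
  the powers avoids roots, as the intersection of \<open>d\<close> of the sets is bounded by the smallest.
\<close>

lemma sum_card_power_le:
  fixes c :: "'w \<Rightarrow> real" and L :: real
  assumes fin: "finite I" "finite B" and d: "d > 0" and L: "L \<ge> 0"
    and c: "\<And>w. w \<in> B \<Longrightarrow> c w \<ge> 0"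
    and F: "\<And>w. w \<in> B \<Longrightarrow> real (card {m\<in>I. R m w}) \<le> L * c w ^ d"
  shows "(\<Sum>m\<in>I. real (card {w\<in>B. R m w}) ^ d) \<le> L * (\<Sum>w\<in>B. c w) ^ d"
proof -
  let ?G = "{..<d} \<rightarrow>\<^sub>E B"
  have inter: "real (card {m\<in>I. \<forall>i<d. R m (g i)}) \<le> L * (\<Prod>i<d. c (g i))" if g: "g \<in> ?G" for g
  proof -
    \<comment> \<open>\<open>k\<close> picks the least value \<open>c (g i)\<close>, so
      \<open>c (g k) ^ d\<close> is at most the product of all of them.\<close>
    obtain k where k: "k < d" "\<And>i. i < d \<Longrightarrow> c (g k) \<le> c (g i)"
      using d ex_min_if_finite[of "(\<lambda>i. c (g i)) ` {..<d}"]
      by (force simp: not_less)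
    have gB: "g i \<in> B" if "i < d" for i using g that by auto
    have "real (card {m\<in>I. \<forall>i<d. R m (g i)}) \<le> real (card {m\<in>I. R m (g k)})"
      using k fin by (intro of_nat_mono card_mono) auto
    also have "\<dots> \<le> L * c (g k) ^ d" using F gB k by blast
    also have "c (g k) ^ d = (\<Prod>i<d. c (g k))" by simp
    also have "L * (\<Prod>i<d. c (g k)) \<le> L * (\<Prod>i<d. c (g i))"
      using k gB c L by (intro mult_left_mono prod_mono) auto
    finally show ?thesis .
  qed
  have card: "real (card {z\<in>X. Q z}) = (\<Sum>z\<in>X. of_bool (Q z))" if "finite X"
    for Q and X :: "'z set"
    using that by (simp add: of_bool_def sum.If_cases Int_def)
  have prod_of_bool: "(\<Prod>i<d. of_bool (Q i)) = (of_bool (\<forall>i<d. Q i) :: real)" for Q :: "nat \<Rightarrow> bool"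
  proof (cases "\<forall>i<d. Q i")
    case False
    then show ?thesis by (auto intro!: prod_zero)
  qed simp
  \<comment> \<open>The \<open>d\<close>-th power of a cardinality counts the maps \<open>g\<close>
    from \<open>{..<d}\<close> into the set; swapping sums leaves an intersection for each
    \<open>g\<close>.\<close>
  have "(\<Sum>m\<in>I. real (card {w\<in>B. R m w}) ^ d) = (\<Sum>m\<in>I. \<Prod>i<d. \<Sum>w\<in>B. of_bool (R m w))"
    by (simp add: card fin)
  also have "\<dots> = (\<Sum>m\<in>I. \<Sum>g\<in>?G. \<Prod>i<d. of_bool (R m (g i)))"
    by (subst prod_sum_PiE) (simp_all add: fin)
  also have "\<dots> = (\<Sum>g\<in>?G. \<Sum>m\<in>I. of_bool (\<forall>i<d. R m (g i)))"
    by (simp only: prod_of_bool) (rule sum.swap)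
  also have "\<dots> = (\<Sum>g\<in>?G. real (card {m\<in>I. \<forall>i<d. R m (g i)}))"
    by (simp add: card fin)
  also have "\<dots> \<le> (\<Sum>g\<in>?G. L * (\<Prod>i<d. c (g i)))"
    by (rule sum_mono) (rule inter)
  also have "\<dots> = L * (\<Prod>i<d. \<Sum>w\<in>B. c w)"
    by (subst prod_sum_PiE) (simp_all add: fin sum_distrib_left)
  finally show ?thesis by simp
qed

section \<open>Tensorising the one-dimensional bound\<close>

lemma tuples_upd_in: "f \<in> tuples q n \<Longrightarrow> m \<in> {1..n} \<Longrightarrow> f(Suc q := m) \<in> tuples (Suc q) n"
  by (auto simp: tuples_def PiE_def extensional_def Pi_def)

lemma bij_betw_tuples_Suc:
  "bij_betw (\<lambda>(m, f). f(Suc q := m)) ({1..n} \<times> tuples q n) (tuples (Suc q) n)"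
proof -
  have "{1..Suc q} = insert (Suc q) {1..q}" by auto
  then show ?thesis
    using inj_combinator[of "Suc q" "{1..q}" "\<lambda>_. {1..n}"]
      PiE_insert_eq[of "Suc q" "{1..q}" "\<lambda>_. {1..n}"]
    by (auto simp: bij_betw_def tuples_def)
qed

text \<open>The first count serves to slice the edge tuples by last edge, the second to split the
  column support into fibres.\<close>

lemma card_tuples_Suc:
  assumes "X \<subseteq> tuples (Suc q) n"
  shows "card X = (\<Sum>m\<in>{1..n}. card {f\<in>tuples q n. f(Suc q := m) \<in> X})"
    and "card X = (\<Sum>f\<in>tuples q n. card {m\<in>{1..n}. f(Suc q := m) \<in> X})"
proof -
  let ?g = "\<lambda>(m, f). f(Suc q := m)"
  have inj: "inj_on ?g ({1..n} \<times> tuples q n)" and im: "?g ` ({1..n} \<times> tuples q n) = tuples (Suc q) n"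
    using bij_betw_tuples_Suc by (auto simp: bij_betw_def)
  let ?Y = "SIGMA m:{1..n}. {f\<in>tuples q n. f(Suc q := m) \<in> X}"
  have "?g ` ?Y = {f\<in>?g ` ({1..n} \<times> tuples q n). f \<in> X}" by auto
  then have "?g ` ?Y = X" using assms unfolding im by blast
  moreover have "inj_on ?g ?Y" by (rule inj_on_subset[OF inj]) auto
  ultimately have X: "card X = card ?Y" using card_image[of ?g ?Y] by simp
  then show "card X = (\<Sum>m\<in>{1..n}. card {f\<in>tuples q n. f(Suc q := m) \<in> X})"
    by (simp add: finite_tuples)
  let ?Z = "SIGMA f:tuples q n. {m\<in>{1..n}. f(Suc q := m) \<in> X}"
  have "?Z = prod.swap ` ?Y" by force
  then have "card ?Z = card ?Y" by (simp add: card_image)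
  then show "card X = (\<Sum>f\<in>tuples q n. card {m\<in>{1..n}. f(Suc q := m) \<in> X})"
    using X by (simp add: finite_tuples)
qed

text \<open>With \<open>h m\<close> the support of row \<open>m\<close> of \<open>P\<close>, row
  \<open>e\<close> of \<open>Q\<close> is supported on the box with sides \<open>h (e l)\<close>, so
  this is the column support of the rows in \<open>X\<close>.\<close>

definition box_union :: "nat \<Rightarrow> nat \<Rightarrow> (nat \<Rightarrow> nat set) \<Rightarrow> (nat \<Rightarrow> nat) set \<Rightarrow> (nat \<Rightarrow> nat) set" where
  "box_union q N h X = {v\<in>tuples q N. \<exists>e\<in>X. \<forall>l\<in>{1..q}. v l \<in> h (e l)}"

text \<open>\<open>expand\<close> is the bound for a single factor. Slices of \<open>X\<close>
  inherit \<open>lines\<close> with the same \<open>s\<close>, so the induction can run.\<close>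

lemma card_le_box_union:
  fixes h :: "nat \<Rightarrow> nat set" and L :: real
  assumes d: "d > 0" and L: "L \<ge> 0"
    and h: "\<And>m. m \<in> {1..M} \<Longrightarrow> h m \<subseteq> {1..N}"
    and expand: "\<And>F W. F \<subseteq> {1..M} \<Longrightarrow> F \<noteq> {} \<Longrightarrow> s \<le> card F \<Longrightarrow> W \<subseteq> {1..N} \<Longrightarrow>
      (\<And>m. m \<in> F \<Longrightarrow> h m \<subseteq> W) \<Longrightarrow> real (card F) \<le> L * real (card W) ^ d"
    and X: "X \<subseteq> tuples q M"
    and lines: "\<And>e l. e \<in> X \<Longrightarrow> l \<in> {1..q} \<Longrightarrow> s \<le> card {m\<in>{1..M}. e(l := m) \<in> X}"
  shows "real (card X) \<le> L ^ q * real (card (box_union q N h X)) ^ d"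
  using X lines
proof (induction q arbitrary: X)
  \<comment> \<open>Both tuple sets are singletons, so the bound reads \<open>0 \<le> 0\<close> or
    \<open>1 \<le> 1\<close>.\<close>
  case 0
  then have "X = {} \<or> X = tuples 0 N" by (auto simp: tuples_def)
  then show ?case by (auto simp: box_union_def tuples_def)
next
  case (Suc q)
  define Y where "Y m = {f\<in>tuples q M. f(Suc q := m) \<in> X}" for m
  define C where "C = box_union (Suc q) N h X"
  define Cw where "Cw w = {v\<in>{1..N}. w(Suc q := v) \<in> C}" for w
  have C: "C \<subseteq> tuples (Suc q) N" by (auto simp: C_def box_union_def)
  have Y: "real (card (Y m)) \<le> L ^ q * real (card (box_union q N h (Y m))) ^ d"
    if m: "m \<in> {1..M}" for m
  proof (rule Suc.IH)
    show "Y m \<subseteq> tuples q M" by (auto simp: Y_def)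
    fix f l assume f: "f \<in> Y m" and l: "l \<in> {1..q}"
    have "f(l := k) \<in> Y m \<longleftrightarrow> f(Suc q := m, l := k) \<in> X" if "k \<in> {1..M}" for k
    proof -
      have "f(l := k) \<in> tuples q M"
        using f l that by (auto simp: Y_def tuples_def PiE_def Pi_def extensional_def)
      moreover have "f(l := k, Suc q := m) = f(Suc q := m, l := k)" using l by auto
      ultimately show ?thesis by (simp add: Y_def)
    qed
    then have "{k\<in>{1..M}. f(l := k) \<in> Y m} = {k\<in>{1..M}. f(Suc q := m, l := k) \<in> X}" by blast
    then show "s \<le> card {k\<in>{1..M}. f(l := k) \<in> Y m}"
      using Suc.prems(2)[of "f(Suc q := m)" l] f l
      by (simp add: Y_def del: fun_upd_apply)
  qed
  have Fw: "real (card {m\<in>{1..M}. w \<in> box_union q N h (Y m)}) \<le> L * real (card (Cw w)) ^ d"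
    (is "real (card ?F) \<le> _") if w: "w \<in> tuples q N" for w
  proof (cases "?F = {}")
    case True
    show ?thesis unfolding True using L by simp
  next
    case False
    then obtain m f where m: "m \<in> {1..M}" and f: "f \<in> Y m" "\<forall>l\<in>{1..q}. w l \<in> h (f l)"
      by (auto simp: box_union_def)
    \<comment> \<open>If \<open>f\<close> covers \<open>w\<close> in one slice, it does so in every
      slice containing \<open>f\<close>. Hence a nonempty \<open>?F\<close> contains the last edges
      of a whole line of \<open>X\<close>.\<close>
    have line: "{k\<in>{1..M}. f(Suc q := k) \<in> X} \<subseteq> ?F"
      using f w by (auto simp: box_union_def Y_def)
    have "s \<le> card {k\<in>{1..M}. f(Suc q := k) \<in> X}"
      using Suc.prems(2)[of "f(Suc q := m)" "Suc q"] f(1)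
      by (simp add: Y_def del: fun_upd_apply)
    also have "\<dots> \<le> card ?F" using line by (intro card_mono) auto
    finally have s: "s \<le> card ?F" .
    \<comment> \<open>A tuple covering \<open>w\<close> in slice \<open>k\<close>, extended by
      \<open>k\<close>, covers \<open>w\<close> extended by any vertex of
      \<open>h k\<close>.\<close>
    have "h k \<subseteq> Cw w" if k: "k \<in> ?F" for k
    proof
      fix v assume v: "v \<in> h k"
      then have vN: "v \<in> {1..N}" using k h by blast
      obtain g where g: "g \<in> Y k" "\<forall>l\<in>{1..q}. w l \<in> h (g l)"
        using k by (auto simp: box_union_def)
      have "w(Suc q := v) \<in> C"
        unfolding C_def box_union_def
        using tuples_upd_in[OF w vN] g v
        by (auto simp: Y_def intro!: bexI[of _ "g(Suc q := k)"])
      then show "v \<in> Cw w" using vN by (simp add: Cw_def)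
    qed
    then show ?thesis using s False by (intro expand) (auto simp: Cw_def)
  qed
  have box: "{w\<in>tuples q N. w \<in> box_union q N h (Y m)} = box_union q N h (Y m)" for m
    by (auto simp: box_union_def)
  have "real (card X) = (\<Sum>m\<in>{1..M}. real (card (Y m)))"
    using card_tuples_Suc(1)[OF Suc.prems(1)] by (simp add: Y_def)
  also have "\<dots> \<le> (\<Sum>m\<in>{1..M}. L ^ q * real (card (box_union q N h (Y m))) ^ d)"
    by (rule sum_mono) (rule Y)
  also have "\<dots> = L ^ q * (\<Sum>m\<in>{1..M}. real (card (box_union q N h (Y m))) ^ d)"
    by (simp add: sum_distrib_left)
  also have "\<dots> \<le> L ^ q * (L * (\<Sum>w\<in>tuples q N. real (card (Cw w))) ^ d)"
    using sum_card_power_le[of "{1..M}" "tuples q N" d L "\<lambda>w. real (card (Cw w))"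
      "\<lambda>m w. w \<in> box_union q N h (Y m)"] Fw d L
    by (intro mult_left_mono) (auto simp: box finite_tuples)
  also have "(\<Sum>w\<in>tuples q N. real (card (Cw w))) = real (card C)"
    using card_tuples_Suc(2)[OF C] by (simp add: Cw_def)
  finally show ?case by (simp add: C_def mult_ac)
qed

section \<open>From matrices and hypergraphs to index sets\<close>

lemma hconcat_eq_iff: "hconcat A B = hconcat A' B' \<longleftrightarrow> A = A' \<and> B = B'"
proof
  assume *: "hconcat A B = hconcat A' B'"
  have "hconcat A B e (Inl c) = hconcat A' B' e (Inl c)"
    "hconcat A B e (Inr c') = hconcat A' B' e (Inr c')" for e c c'
    using * by simp_all
  then show "A = A' \<and> B = B'" by (simp add: hconcat_def fun_eq_iff)
qed simp

text \<open>This removes the numberings of hyperedges and vertices; as they are bijective, the edge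
  bound for subsets of \<open>V\<close> transfers to sets of column indices.\<close>

lemma indicator_matrix_row_supports:
  assumes ind: "indicator_matrix V E P" and E: "\<And>g. g \<in> E \<Longrightarrow> g \<subseteq> V"
  obtains h :: "nat \<Rightarrow> nat set"
  where "\<forall>i\<in>{1..card E}. \<forall>j\<in>{1..card V}. P i j \<noteq> 0 \<longleftrightarrow> j \<in> h i"
    and "\<forall>i\<in>{1..card E}. h i \<subseteq> {1..card V}"
    and "\<forall>W\<subseteq>{1..card V}. \<exists>V'\<subseteq>V. card V' = card W \<and>
      card {i\<in>{1..card E}. h i \<subseteq> W} = card {g\<in>E. g \<subseteq> V'}"
proof -
  obtain edge vert where edge: "bij_betw edge {1..card E} E"
    and vert: "bij_betw vert {1..card V} V"
    and P: "\<And>i j. i \<in> {1..card E} \<Longrightarrow> j \<in> {1..card V} \<Longrightarrow>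
      P i j = (if vert j \<in> edge i then 1 else 0)"
    using ind unfolding indicator_matrix_def by blast
  define h where "h i = {j\<in>{1..card V}. vert j \<in> edge i}" for i
  show ?thesis
  proof (rule that; (intro ballI allI impI)?)
    fix W assume W: "W \<subseteq> {1..card V}"
    have vV: "vert ` {1..card V} = V" and vinj: "inj_on vert {1..card V}"
      using vert by (auto simp: bij_betw_def)
    have sub: "h i \<subseteq> W \<longleftrightarrow> edge i \<subseteq> vert ` W" if i: "i \<in> {1..card E}" for i
    proof -
      have eV: "edge i \<subseteq> V" using E bij_betw_apply[OF edge i] by blast
      show ?thesis
      proof
        assume "h i \<subseteq> W"
        moreover have "edge i \<subseteq> vert ` h i"
        proof
          fix v assume v: "v \<in> edge i"
          then obtain j where "j \<in> {1..card V}" "v = vert j" using eV vV by blast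
          then show "v \<in> vert ` h i" using v by (simp add: h_def)
        qed
        ultimately show "edge i \<subseteq> vert ` W" by blast
      next
        assume edgeW: "edge i \<subseteq> vert ` W"
        show "h i \<subseteq> W"
        proof
          fix j assume j: "j \<in> h i"
          then obtain k where "k \<in> W" "vert j = vert k" using edgeW by (auto simp: h_def)
          then show "j \<in> W" using inj_onD[OF vinj, of j k] j W by (auto simp: h_def)
        qed
      qed
    qed
    have "bij_betw edge {i\<in>{1..card E}. h i \<subseteq> W} {g\<in>E. g \<subseteq> vert ` W}"
      by (rule bij_betw_Collect[OF edge]) (simp add: sub)
    then have "card {i\<in>{1..card E}. h i \<subseteq> W} = card {g\<in>E. g \<subseteq> vert ` W}"
      by (rule bij_betw_same_card)
    moreover have "card (vert ` W) = card W" by (rule card_image[OF inj_on_subset[OF vinj W]])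
    moreover have "vert ` W \<subseteq> V" using vV W by blast
    ultimately show "\<exists>V'\<subseteq>V. card V' = card W \<and>
      card {i\<in>{1..card E}. h i \<subseteq> W} = card {g\<in>E. g \<subseteq> V'}"
      by blast
  qed (auto simp: h_def P)
qed

section \<open>Assembling the bound\<close>

theorem theorem4p5:
  fixes V :: "'v set" and E :: "'v set set"
    and d N M t q :: nat and \<beta> :: real
    and P :: "(nat, nat) int_matrix"
    and A :: "(nat \<Rightarrow> nat, (nat \<Rightarrow> nat) set \<times> nat) int_matrix"
    and Q :: "(nat \<Rightarrow> nat, nat \<Rightarrow> nat) int_matrix"
    and T :: "(nat \<Rightarrow> nat, ((nat \<Rightarrow> nat) set \<times> nat) + (nat \<Rightarrow> nat)) int_matrix"
  assumes "hypergraph d V E" and "N = card V" and "M = card E"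
    and "0 \<le> \<beta>" and "\<beta> \<le> 1" and "t > 0" and "q > 0"
    and "t dvd M"
    and "1 / real t > \<beta>"
    and "\<forall>V'\<subseteq>V. real (card {h\<in>E. h \<subseteq> V'})
           \<le> (real (card V') / real N) ^ d * real M + \<beta> * real M"
    and "indicator_matrix V E P"
    and "VF_tensor_product M t q P T" and "T = hconcat A Q"
  shows "\<forall>(x :: (nat \<Rightarrow> nat) \<Rightarrow> int) (\<delta> :: real).
           (\<forall>c\<in>VF_columns M t q. vec_mat_mult (tuples q M) x A c = 0) \<and> 0 \<le> \<delta> \<and> \<delta> \<le> 1 \<longrightarrow>
           (let E' = {e\<in>tuples q M. x e \<noteq> 0} in
              real (card E') > real M ^ q * \<delta> ^ d / (1 - \<beta> * real t) ^ q \<longrightarrow>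
              real (card (column_support E' (tuples q N) Q)) > real N ^ q * \<delta>)"
proof (intro allI impI)
  fix x :: "(nat \<Rightarrow> nat) \<Rightarrow> int" and \<delta> :: real
  assume x\<delta>: "(\<forall>c\<in>VF_columns M t q. vec_mat_mult (tuples q M) x A c = 0) \<and> 0 \<le> \<delta> \<and> \<delta> \<le> 1"
  define X where "X = {e\<in>tuples q M. x e \<noteq> 0}"
  define C where "C = column_support X (tuples q N) Q"
  obtain a r where ar: "prime a" "M ^ q < a" "a < 3 * M ^ q"
    "bij_betw r (tuples q M) {1..M ^ q}"
    and A: "A = hconcat_family (VF_block (reduced_vandermonde a) r)" and Q: "Q = tensor_power q P"
    using assms(12,13) unfolding VF_tensor_product_def by (auto simp: hconcat_eq_iff)
  \<comment> \<open>For \<open>M = 0\<close> the condition \<open>a < 3 * M ^ q\<close> would read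
    \<open>a < 0\<close>.\<close>
  have M: "M > 0" using ar \<open>q > 0\<close> by (cases "M = 0") (auto simp: power_0_left)
  have E: "g \<subseteq> V" "card g = d" if "g \<in> E" for g
    using that assms(1) by (auto simp: hypergraph_def)
  have finV: "finite V" using assms(1) by (simp add: hypergraph_def)
  have \<beta>t: "0 < 1 - \<beta> * real t" "1 - \<beta> * real t \<le> 1"
    using assms(4,6,9) by (auto simp: field_simps)
  have lines: "M div t \<le> card {m\<in>{1..M}. e(l := m) \<in> X}" if "e \<in> X" "l \<in> {1..q}" for e l
    using line_support_large[OF ar(1,2,4), of t x e l] x\<delta> that
    unfolding A X_def by (auto intro: less_imp_le)
  have "real (card C) > real N ^ q * \<delta>"
    if large: "real (card X) > real M ^ q * \<delta> ^ d / (1 - \<beta> * real t) ^ q"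
  proof (cases "d = 0")
    \<comment> \<open>The only possible hyperedge is the empty set, so \<open>M = 1\<close> and
      \<open>X\<close> has at most one point, whereas \<open>large\<close> asks for more than
      \<open>1 / (1 - \<beta> * real t) ^ q\<close>, which is at least 1.\<close>
    case True
    then have "E \<subseteq> {{}}" using E finV True by (metis card_0_eq finite_subset singletonI subsetI)
    then have "M \<le> 1" using card_mono[of "{{}}" E] assms(3) by auto
    then have "M = 1" using M by simp
    then have "card X \<le> 1"
      unfolding X_def using card_mono[OF finite_tuples, of X q 1]
      by (auto simp: tuples_def card_PiE X_def)
    moreover have "(1 - \<beta> * real t) ^ q \<le> 1" using \<beta>t by (intro power_le_one) auto
    then have "1 \<le> 1 / (1 - \<beta> * real t) ^ q" using \<beta>t by simp
    ultimately show ?thesis using large True \<open>M = 1\<close> by simp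
  next
    case False
    then have d: "d > 0" by simp
    have N: "N > 0"
    proof (rule ccontr)
      assume "\<not> N > 0"
      then have "V = {}" using finV assms(2) by simp
      then have "E = {}" using E False by (metis card.empty equals0I subset_empty)
      then show False using M assms(3) by simp
    qed
    obtain h where P: "\<forall>i\<in>{1..M}. \<forall>j\<in>{1..N}. P i j \<noteq> 0 \<longleftrightarrow> j \<in> h i"
      and h: "\<forall>i\<in>{1..M}. h i \<subseteq> {1..N}"
      and hV: "\<forall>W\<subseteq>{1..N}. \<exists>V'\<subseteq>V. card V' = card W \<and>
        card {i\<in>{1..M}. h i \<subseteq> W} = card {g\<in>E. g \<subseteq> V'}"
      by (rule indicator_matrix_row_supports[OF assms(11) E(1), folded assms(2,3)])
    have C: "C = box_union q N h X"
    proof -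
      have "Q e v \<noteq> 0 \<longleftrightarrow> (\<forall>l\<in>{1..q}. v l \<in> h (e l))" if "e \<in> X" "v \<in> tuples q N" for e v
      proof -
        have "e l \<in> {1..M}" "v l \<in> {1..N}" if "l \<in> {1..q}" for l
          using \<open>e \<in> X\<close> \<open>v \<in> tuples q N\<close> that by (auto simp: X_def tuples_def)
        then show ?thesis using P by (simp add: Q tensor_power_def)
      qed
      then show ?thesis unfolding C_def column_support_def box_union_def by blast
    qed
    \<comment> \<open>\<open>L\<close> arises from solving
      \<open>|F| \<le> (|W| / N) ^ d * M + \<beta> * t * |F|\<close> for \<open>|F|\<close>.\<close>
    define L where "L = real M / (real N ^ d * (1 - \<beta> * real t))"
    have L: "L > 0" using M N \<beta>t by (simp add: L_def)
    have expand: "real (card F) \<le> L * real (card W) ^ d"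
      if F: "F \<subseteq> {1..M}" "M div t \<le> card F" and W: "W \<subseteq> {1..N}" "\<And>m. m \<in> F \<Longrightarrow> h m \<subseteq> W"
      for F W
    proof -
      obtain V' where V': "V' \<subseteq> V" "card V' = card W"
        "card {i\<in>{1..M}. h i \<subseteq> W} = card {g\<in>E. g \<subseteq> V'}"
        using hV W(1) by blast
      have "card F \<le> card {i\<in>{1..M}. h i \<subseteq> W}"
        using F W by (intro card_mono) auto
      then have "real (card F) \<le> real (card {g\<in>E. g \<subseteq> V'})" using V' by simp
      also have "\<dots> \<le> (real (card W) / real N) ^ d * real M + \<beta> * real M"
        using assms(10) V' by metis
      also have "\<beta> * real M \<le> \<beta> * real t * real (card F)"
      proof -
        have "M \<le> t * card F"
          using F(2) \<open>t dvd M\<close> by (metis dvd_mult_div_cancel mult_le_mono2)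
        then have "real M \<le> real t * real (card F)" by (metis of_nat_le_iff of_nat_mult)
        then show ?thesis using assms(4) by (simp add: mult.assoc mult_left_mono)
      qed
      finally have "real (card F) * (1 - \<beta> * real t) \<le> (real (card W) / real N) ^ d * real M"
        by (simp add: algebra_simps)
      then have "real (card F) \<le> (real (card W) / real N) ^ d * real M / (1 - \<beta> * real t)"
        using \<beta>t by (simp add: pos_le_divide_eq)
      then show ?thesis by (simp add: L_def power_divide mult_ac)
    qed
    have "real (card X) \<le> L ^ q * real (card C) ^ d"
      unfolding C using lines L d h expand
      by (intro card_le_box_union[where M = M and s = "M div t"]) (auto simp: X_def)
    \<comment> \<open>The threshold is exactly the upper bound with \<open>card C\<close> replaced
      by \<open>N ^ q * \<delta>\<close>, so it remains to compare the bases of two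
      \<open>d\<close>-th powers.\<close>
    moreover have "real M ^ q * \<delta> ^ d / (1 - \<beta> * real t) ^ q = L ^ q * (real N ^ q * \<delta>) ^ d"
      using N by (simp add: L_def power_divide power_mult_distrib power_mult[symmetric] mult.commute[of d q])
    ultimately have "L ^ q * (real N ^ q * \<delta>) ^ d < L ^ q * real (card C) ^ d"
      using large by simp
    then have "(real N ^ q * \<delta>) ^ d < real (card C) ^ d" using L by simp
    then show ?thesis by (rule power_less_imp_less_base) simp
  qed
  then show "let E' = {e\<in>tuples q M. x e \<noteq> 0} in
      real (card E') > real M ^ q * \<delta> ^ d / (1 - \<beta> * real t) ^ q \<longrightarrow>
      real (card (column_support E' (tuples q N) Q)) > real N ^ q * \<delta>"
    by (simp add: Let_def X_def C_def)
qed

end
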